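(* Suppose that the $n\times p$ design matrix $X$ satisfies the coherence property and let the noise vector $\eta$ be distributed as $\mathcal{CN}(\mathbf 0,\sigma^2I)$. Let $y=X\beta+\eta$, let $p\ge128$, fix any $t\in(0,1)$, and choose the threshold $$\lambda=\max\Big\{\tfrac{1}{t}\,10\,\mu\sqrt{n\cdot \mathrm{SNR}},\ \tfrac{1}{1-t}\sqrt{2}\Big\}\sqrt{2\sigma^2\log p},\qquad \mu=\mu(X).$$ Then the estimate $\widehat{\mathcal S}$ returned by the OST algorithm with threshold $\lambda$ satisfies $\Pr(\widehat{\mathcal S}\ne\mathcal S)\le 6p^{-1}$ as long as $k\le n/(2\log p)$ and $$\mathrm{MAR}>\max\Bigg\{8(1-t)^{-2}\Big(\frac{2k\log p}{n\cdot\mathrm{SNR}}\Big),\ 400\,t^{-2}\Big(\frac{2k\log p}{\mu^{-2}}\Big)\Bigg\}.$$ Here the probability is with respect to the true model $\mathcal S$ and the noise vector $\eta$.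
   Context: Setting. $k<n\le p$ are positive integers, $X$ is a fixed real- or complex-valued $n\times p$ matrix whose columns $\mathrm{x}_1,\dots,\mathrm{x}_p$ have unit $\ell_2$-norm, and $\log$ is the natural logarithm. The noise $\eta\in\mathbb C^n$ has i.i.d. circularly symmetric complex Gaussian entries of variance $\sigma^2>0$ (so $\mathbb E\|\eta\|_2^2=n\sigma^2$). Signal model. The signal $\beta\in\mathbb C^p$ is $k$-sparse with uniformly random support: there are a fixed vector $z\in\mathbb C^k$ with all entries nonzero and a uniformly random permutation $(\pi_1,\dots,\pi_p)$ of $\{1,\dots,p\}$, independent of $\eta$, with $\beta_{\pi_i}=z_i$ for $i\le k$ and all other entries of $\beta$ equal to $0$. The true model is $\mathcal S=\{i:|\beta_i|>0\}=\{\pi_1,\dots,\pi_k\}$. Coherence. $\mu(X)=\max_{i\ne j}|\langle \mathrm{x}_i,\mathrm{x}_j\rangle|$ and $\nu(X)=\frac1{p-1}\max_i\big|\sum_{j\neq i}\langle \mathrm{x}_i,\mathrm{x}_j\rangle\big|$. $X$ satisfies the coherence property if $\mu(X)\le \frac{0.1}{\sqrt{2\log p}}$ and $\nu(X)\le \frac{\mu(X)}{\sqrt n}$. The expression $a/\mu^{-2}$ means $a\mu^2$. Signal quantities. $\beta_{\min}=\min_{i\in\mathcal S}|\beta_i|$, $\mathrm{MAR}=\frac{\beta_{\min}^2}{\|\beta\|_2^2/k}$, $\mathrm{SNR}=\frac{\|\beta\|_2^2}{\mathbb E[\|\eta\|_2^2]}$. OST algorithm (one-step thresholding). Given $X$,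 $y$ and $\lambda>0$: compute $f=X^{\mathrm H}y$ and output $\widehat{\mathcal S}=\{i\in\{1,\dots,p\}:|f_i|>\lambda\}$. *)

theory Defs
  imports "HOL-Probability.Probability" "HOL-Combinatorics.Multiset_Permutations"
begin

text \<open>
  An \<open>n\<close> by \<open>p\<close> matrix is an element of \<open>complex ^ 'p ^ 'n\<close>, with \<open>n = CARD('n)\<close> and
  \<open>p = CARD('p)\<close>. Real matrices are the special case where all entries are real.
\<close>

definition cinner :: "complex ^ 'n \<Rightarrow> complex ^ 'n \<Rightarrow> complex" where
  "cinner u v = (\<Sum>i\<in>UNIV. u $ i * cnj (v $ i))"

definition hermitian_transpose :: "complex ^ 'p ^ 'n \<Rightarrow> complex ^ 'n ^ 'p" where
  "hermitian_transpose X = (\<chi> j i. cnj (X $ i $ j))"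

text \<open>Worst-case coherence; only meaningful for at least two columns.\<close>

definition worst_coherence :: "complex ^ 'p ^ 'n \<Rightarrow> real" where
  "worst_coherence X = Max {cmod (cinner (column i X) (column j X)) | i j. i \<noteq> j}"

text \<open>Average coherence.\<close>

definition average_coherence :: "complex ^ 'p ^ 'n \<Rightarrow> real" where
  "average_coherence X =
     1 / (real CARD('p) - 1) *
     Max (range (\<lambda>i. cmod (\<Sum>j\<in>UNIV - {i}. cinner (column i X) (column j X))))"

definition coherence_property :: "complex ^ 'p ^ 'n \<Rightarrow> bool" where
  "coherence_property X \<longleftrightarrow>
     worst_coherence X \<le> 0.1 / sqrt (2 * ln (real CARD('p))) \<and>
     average_coherence X \<le> worst_coherence X / sqrt (real CARD('n))"

text \<open>
  A circularly symmetric complex Gaussian of variance \<open>\<sigma>\<^sup>2\<close> has independent real and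
  imaginary parts, each a centred normal of variance \<open>\<sigma>\<^sup>2 / 2\<close>. The second parameter of
  \<^const>\<open>normal_density\<close> is the standard deviation, whence \<open>\<sigma> / sqrt 2\<close>.
\<close>

definition circular_complex_normal :: "'w measure \<Rightarrow> real \<Rightarrow> ('w \<Rightarrow> complex) \<Rightarrow> bool" where
  "circular_complex_normal M \<sigma> Z \<longleftrightarrow>
     distributed M lborel (\<lambda>\<omega>. Re (Z \<omega>)) (normal_density 0 (\<sigma> / sqrt 2)) \<and>
     distributed M lborel (\<lambda>\<omega>. Im (Z \<omega>)) (normal_density 0 (\<sigma> / sqrt 2)) \<and>
     prob_space.indep_var M borel (\<lambda>\<omega>. Re (Z \<omega>)) borel (\<lambda>\<omega>. Im (Z \<omega>))"

definition complex_normal_noise :: "'w measure \<Rightarrow> real \<Rightarrow> ('w \<Rightarrow> complex ^ 'n) \<Rightarrow> bool" where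
  "complex_normal_noise M \<sigma> \<eta> \<longleftrightarrow>
     (\<forall>i. circular_complex_normal M \<sigma> (\<lambda>\<omega>. \<eta> \<omega> $ i)) \<and>
     prob_space.indep_vars M (\<lambda>_. borel) (\<lambda>i \<omega>. \<eta> \<omega> $ i) UNIV"

text \<open>
  A permutation \<open>(\<pi>\<^sub>1, \<dots>, \<pi>\<^sub>p)\<close> of the column indices is a list that enumerates
  \<^typ>\<open>'p\<close> without repetition.
\<close>

definition uniform_random_permutation :: "'w measure \<Rightarrow> ('w \<Rightarrow> 'p::finite list) \<Rightarrow> bool" where
  "uniform_random_permutation M \<pi> \<longleftrightarrow>
     \<pi> \<in> measurable M (count_space (permutations_of_set UNIV)) \<and>
     distr M (count_space (permutations_of_set UNIV)) \<pi> =
       uniform_count_measure (permutations_of_set UNIV)"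

text \<open>
  Independence of random elements of different types: the library's \<open>indep_var\<close> needs both to
  take values in the same type, so this states independence of the generated \<open>\<sigma>\<close>-algebras.
\<close>

definition indep_random_elements ::
    "'w measure \<Rightarrow> 'a measure \<Rightarrow> ('w \<Rightarrow> 'a) \<Rightarrow> 'b measure \<Rightarrow> ('w \<Rightarrow> 'b) \<Rightarrow> bool" where
  "indep_random_elements M N\<^sub>1 U N\<^sub>2 V \<longleftrightarrow>
     prob_space.indep_set M {U -` A \<inter> space M | A. A \<in> sets N\<^sub>1}
                            {V -` B \<inter> space M | B. B \<in> sets N\<^sub>2}"

definition model :: "complex ^ 'p \<Rightarrow> 'p set" where
  "model b = {i. cmod (b $ i) > 0}"

definition beta_min :: "complex ^ 'p \<Rightarrow> real" where
  "beta_min b = Min ((\<lambda>i. cmod (b $ i)) ` model b)"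

text \<open>Minimum-to-average ratio of a \<open>k\<close>-sparse vector.\<close>

definition MAR :: "nat \<Rightarrow> complex ^ 'p \<Rightarrow> real" where
  "MAR k b = (beta_min b)\<^sup>2 / ((norm b)\<^sup>2 / real k)"

definition SNR :: "'w measure \<Rightarrow> ('w \<Rightarrow> complex ^ 'n) \<Rightarrow> complex ^ 'p \<Rightarrow> real" where
  "SNR M \<eta> b = (norm b)\<^sup>2 / (\<integral>\<omega>. (norm (\<eta> \<omega>))\<^sup>2 \<partial>M)"

text \<open>One-step thresholding.\<close>

definition OST :: "complex ^ 'p ^ 'n \<Rightarrow> complex ^ 'n \<Rightarrow> real \<Rightarrow> 'p set" where
  "OST X y \<tau> = {i. cmod ((hermitian_transpose X *v y) $ i) > \<tau>}"

end

theory Submission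
  imports Defs
begin

text \<open>
  The correlation of the observation with column \<open>j\<close> is
  \<open>f\<^sub>j = \<beta>\<^sub>j + W\<^sub>j + V\<^sub>j\<close>. Here \<open>W\<^sub>j\<close> is the interference from the other active columns, a
  weighted sum \<open>\<Sum> z\<^sub>l g\<^sub>j(\<pi>\<^sub>l)\<close> of the inner products \<open>g\<^sub>j(i)\<close> of column \<open>i \<noteq> j\<close> with column
  \<open>j\<close>, sampled without replacement, and \<open>V\<^sub>j\<close> is the projection of the noise on column \<open>j\<close>. The
  threshold \<open>\<tau>\<close> is made so that \<open>t \<tau>\<close> dominates typical interference and \<open>(1 - t) \<tau>\<close> typical
  noise, so that the total error in each \<open>f\<^sub>j\<close> is at most \<open>\<tau>\<close>. The bound on MAR says precisely that
  every nonzero \<open>|\<beta>\<^sub>j|\<close> exceeds \<open>2 \<tau>\<close>, and then thresholding at \<open>\<tau>\<close> separates the model from its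
  complement (\<open>OST_eq_model\<close>, \<open>threshold_splits_error_budget\<close>). It remains to bound the probability
  that some \<open>W\<^sub>j\<close> or \<open>V\<^sub>j\<close> is large.

  Both tails come from exponential moments. For the noise these are explicit Gaussian integrals, and
  a union bound over the \<open>p\<close> columns costs \<open>4/p\<close>. For the interference, revealing the permutation
  one entry at a time gives a martingale. The effect of one draw is twofold: it contributes its own
  term, and it removes an item from the pool that the later draws average over. Hence step \<open>l\<close> has the
  size of \<open>z\<^sub>l\<close> minus the mean of the remaining weights. By the updating formula for sums of squared
  deviations, the squares of these steps add up to at most \<open>2 \<Sum> |z\<^sub>l|\<^sup>2\<close>, so that Hoeffding's lemma
  at each step yields a sub-Gaussian bound much as for independent draws (\<open>sum_exp_permutations_le\<close>). The
  centre of \<open>W\<^sub>j\<close> is controlled by the average coherence, and its spread by the worst-case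
  coherence. The resulting union bound is of the order of \<open>p\<^sup>-\<^sup>7\<close>, so the interference fits easily
  into the remaining \<open>2/p\<close>.
\<close>

section \<open>Exponential moments of sampling without replacement\<close>

text \<open>
  Hoeffding's lemma for the uniform distribution on \<open>A\<close>, cleared of denominators so that it applies
  directly to one level of a sum over permutations.
\<close>

lemma sum_exp_le_card_mult_exp:
  fixes h :: "'a \<Rightarrow> real"
  assumes "finite A" "A \<noteq> {}" "\<And>x. x \<in> A \<Longrightarrow> \<bar>h x\<bar> \<le> c"
  shows "(\<Sum>x\<in>A. exp (h x)) \<le> card A * exp ((\<Sum>x\<in>A. h x) / card A + c\<^sup>2 / 2)"
proof -
  let ?M = "measure_pmf (pmf_of_set A)"
  let ?m = "(\<Sum>x\<in>A. h x) / card A"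
  have n: "real (card A) > 0"
    using assms by (simp add: card_gt_0_iff)
  interpret interval_bounded_random_variable ?M h "-c" c
    using assms by unfold_locales (auto simp: AE_measure_pmf_iff set_pmf_of_set abs_le_iff minus_le_iff)
  have E: "measure_pmf.expectation (pmf_of_set A) h = ?m"
    by (rule integral_pmf_of_set[OF assms(2,1)])
  have "(\<integral>\<^sup>+x. exp (h x - ?m) \<partial>?M) \<le> ennreal (exp (c\<^sup>2 / 2))"
    using Hoeffdings_lemma_nn_integral[of 1] unfolding E by (simp add: power2_eq_square)
  also have "(\<integral>\<^sup>+x. exp (h x - ?m) \<partial>?M) = ennreal ((\<Sum>x\<in>A. exp (h x - ?m)) / card A)"
    using n by (simp add: nn_integral_pmf_of_set[OF assms(2,1)] sum_nonneg divide_ennreal[symmetric]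
        ennreal_of_nat_eq_real_of_nat sum_ennreal)
  finally have "(\<Sum>x\<in>A. exp (h x - ?m)) / card A \<le> exp (c\<^sup>2 / 2)"
    by (simp add: ennreal_le_iff)
  then have "(\<Sum>x\<in>A. exp (h x - ?m)) \<le> card A * exp (c\<^sup>2 / 2)"
    using n by (simp add: field_simps)
  from mult_right_mono[OF this, of "exp ?m"] show ?thesis
    by (simp add: sum_distrib_right flip: exp_add) (simp add: exp_add mult_ac)
qed

lemma sum_permutations_of_set_Cons:
  assumes "finite A" "A \<noteq> {}"
  shows "(\<Sum>xs\<in>permutations_of_set A. f xs) =
    (\<Sum>x\<in>A. \<Sum>xs\<in>permutations_of_set (A - {x}). f (x # xs))"
proof -
  have "(\<Sum>xs\<in>permutations_of_set A. f xs) =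
      (\<Sum>x\<in>A. sum f ((#) x ` permutations_of_set (A - {x})))"
    unfolding permutations_of_set_nonempty[OF assms(2)]
    using assms(1) by (intro sum.UNION_disjoint) auto
  then show ?thesis
    by (simp add: sum.reindex)
qed

text \<open>
  The updating formula for sums of squared deviations. Let \<open>b\<close> be the sum of \<open>n\<close> weights. Prepending
  the weight \<open>a\<close> increases their sum of squared deviations from the mean by the right-hand side.
\<close>

lemma sum_squares_deviation_insert:
  fixes a b :: complex
  assumes "0 < n"
  shows "(cmod a)\<^sup>2 + (cmod b)\<^sup>2 / real n - (cmod (a + b))\<^sup>2 / real (Suc n) =
    real n / real (Suc n) * (cmod (a - b / of_nat n))\<^sup>2"
proof -
  have *: "x\<^sup>2 + y\<^sup>2 / real n - (x + y)\<^sup>2 / real (Suc n) =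
      real n / real (Suc n) * (x - y / real n)\<^sup>2" for x y :: real
    using assms by (simp add: divide_simps) (simp add: power2_eq_square algebra_simps)
  show ?thesis
    using *[of "Re a" "Re b"] *[of "Im a" "Im b"]
    by (simp add: cmod_power2 add_divide_distrib distrib_left del: of_nat_Suc)
qed

text \<open>
  Subtracting the squared mean of the weights on the right is what makes the induction close. When
  \<open>x\<close> is drawn first, the remaining pool has lost \<open>x\<close>, so the induction hypothesis contributes
  \<open>- W g(x) / n\<close> with \<open>W\<close> the sum of the remaining \<open>n\<close> weights. The coefficient of \<open>g(x)\<close> is
  therefore \<open>c = w\<^sub>0 - W / n\<close>, and Hoeffding's lemma costs \<open>\<mu>\<^sup>2 |c|\<^sup>2 / 2\<close>. The updating formula
  provides \<open>\<mu>\<^sup>2 |c|\<^sup>2 n / (n + 1)\<close>, which is enough since \<open>n \<ge> 1\<close>. Draws that do not count have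
  weight zero, so a sample of any size is covered by weights on all positions.
\<close>

lemma sum_exp_permutations_le:
  fixes g :: "'a \<Rightarrow> complex" and w :: "nat \<Rightarrow> complex"
  assumes "finite A" "\<And>x. x \<in> A \<Longrightarrow> cmod (g x) \<le> \<mu>"
  shows "(\<Sum>xs\<in>permutations_of_set A. exp (Re (\<Sum>l<card A. w l * g (xs ! l)))) \<le>
    fact (card A) * exp (Re ((\<Sum>l<card A. w l) * (\<Sum>x\<in>A. g x)) / card A +
      \<mu>\<^sup>2 * ((\<Sum>l<card A. (cmod (w l))\<^sup>2) - (cmod (\<Sum>l<card A. w l))\<^sup>2 / card A))"
  using assms
proof (induction "card A" arbitrary: A w)
  case 0
  then show ?case by simp
next
  case (Suc n)
  have fin: "finite A" and ne: "A \<noteq> {}" and cA: "card A = Suc n"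
    using Suc.hyps Suc.prems by auto
  show ?case
  proof (cases "n = 0")
    case True
    then obtain x where "A = {x}"
      using cA by (metis One_nat_def card_1_singletonE)
    then show ?thesis by simp
  next
    case False
    then have n: "0 < n" by simp
    define W G S where "W = (\<Sum>l<n. w (Suc l))" and "G = (\<Sum>x\<in>A. g x)"
      and "S = (\<Sum>l<n. (cmod (w (Suc l)))\<^sup>2)"
    define c where "c = w 0 - W / of_nat n"
    \<comment> \<open>the part of the exponent for the later draws that does not depend on the first one\<close>
    define D where "D = Re (W * G) / n + \<mu>\<^sup>2 * (S - (cmod W)\<^sup>2 / n)"
    have step: "(\<Sum>xs\<in>permutations_of_set (A - {x}).
          exp (Re (\<Sum>l<Suc n. w l * g ((x # xs) ! l)))) \<le> fact n * exp D * exp (Re (c * g x))"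
      if x: "x \<in> A" for x
    proof -
      have card: "card (A - {x}) = n"
        using x fin cA by simp
      have sum: "(\<Sum>y\<in>A - {x}. g y) = G - g x"
        using x fin by (simp add: G_def sum_diff1)
      have "(\<Sum>xs\<in>permutations_of_set (A - {x}). exp (Re (\<Sum>l<Suc n. w l * g ((x # xs) ! l)))) =
          exp (Re (w 0 * g x)) *
          (\<Sum>xs\<in>permutations_of_set (A - {x}). exp (Re (\<Sum>l<n. w (Suc l) * g (xs ! l))))"
        by (simp add: sum.lessThan_Suc_shift exp_add sum_distrib_left del: sum.lessThan_Suc times_complex.sel)
      also have "\<dots> \<le> exp (Re (w 0 * g x)) * (fact n *
          exp (Re (W * (G - g x)) / n + \<mu>\<^sup>2 * (S - (cmod W)\<^sup>2 / n)))"
        using Suc.hyps(1)[of "A - {x}" "\<lambda>l. w (Suc l)"] Suc.prems fin card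
        unfolding W_def S_def sum[symmetric] by (intro mult_left_mono) auto
      also have "\<dots> = fact n * exp (Re (w 0 * g x) + (Re (W * (G - g x)) / n + \<mu>\<^sup>2 * (S - (cmod W)\<^sup>2 / n)))"
        by (simp add: exp_add)
      also have "Re (w 0 * g x) + (Re (W * (G - g x)) / n + \<mu>\<^sup>2 * (S - (cmod W)\<^sup>2 / n)) = D + Re (c * g x)"
        using n by (simp add: D_def c_def field_simps)
      finally show ?thesis
        by (simp add: exp_add)
    qed
    have bd: "\<bar>Re (c * g x)\<bar> \<le> cmod c * \<mu>" if "x \<in> A" for x
      using abs_Re_le_cmod[of "c * g x"] mult_left_mono[OF Suc.prems(2)[OF that], of "cmod c"]
      by (simp add: norm_mult)
    have "(\<Sum>xs\<in>permutations_of_set A. exp (Re (\<Sum>l<card A. w l * g (xs ! l)))) \<le>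
        (\<Sum>x\<in>A. fact n * exp D * exp (Re (c * g x)))"
      unfolding sum_permutations_of_set_Cons[OF fin ne] cA
      by (intro sum_mono step)
    also have "\<dots> \<le> fact n * exp D * (card A * exp ((\<Sum>x\<in>A. Re (c * g x)) / card A + (cmod c * \<mu>)\<^sup>2 / 2))"
      unfolding sum_distrib_left[symmetric]
      by (intro mult_left_mono sum_exp_le_card_mult_exp fin ne bd) auto
    also have "\<dots> = fact (Suc n) * exp (D + (Re (c * G) / Suc n + (cmod c * \<mu>)\<^sup>2 / 2))"
      by (simp only: cA exp_add G_def sum_distrib_left Re_sum fact_Suc of_nat_mult of_nat_fact mult_ac)
    also have "\<dots> \<le> fact (Suc n) * exp (Re ((w 0 + W) * G) / Suc n +
        \<mu>\<^sup>2 * ((cmod (w 0))\<^sup>2 + S - (cmod (w 0 + W))\<^sup>2 / Suc n))"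
    proof -
      have mean: "Re (W * G) / n + Re (c * G) / Suc n = Re ((w 0 + W) * G) / Suc n"
        using n by (simp add: c_def divide_simps) (simp add: algebra_simps)?
      have "(cmod c)\<^sup>2 / 2 \<le> real n / real (Suc n) * (cmod c)\<^sup>2"
      proof -
        have "1 / 2 \<le> real n / real (Suc n)"
          using n by (simp add: field_simps)
        from mult_right_mono[OF this, of "(cmod c)\<^sup>2"] show ?thesis by simp
      qed
      also have "\<dots> = (cmod (w 0))\<^sup>2 + (cmod W)\<^sup>2 / n - (cmod (w 0 + W))\<^sup>2 / Suc n"
        unfolding c_def by (rule sum_squares_deviation_insert[OF n, symmetric])
      finally have "\<mu>\<^sup>2 * ((cmod c)\<^sup>2 / 2) \<le>
          \<mu>\<^sup>2 * ((cmod (w 0))\<^sup>2 + (cmod W)\<^sup>2 / n - (cmod (w 0 + W))\<^sup>2 / Suc n)"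
        by (intro mult_left_mono) auto
      then have var: "\<mu>\<^sup>2 * (S - (cmod W)\<^sup>2 / n) + (cmod c * \<mu>)\<^sup>2 / 2 \<le>
          \<mu>\<^sup>2 * ((cmod (w 0))\<^sup>2 + S - (cmod (w 0 + W))\<^sup>2 / Suc n)"
        by (simp add: power_mult_distrib right_diff_distrib distrib_left mult_ac)
      show ?thesis
        using mean var unfolding D_def by (intro mult_left_mono) auto
    qed
    finally show ?thesis
      by (simp only: cA sum.lessThan_Suc_shift W_def S_def G_def o_def)
  qed
qed

section \<open>Tails of complex random variables from exponential moments\<close>

text \<open>
  A complex number of modulus at least \<open>sqrt 2 * r\<close> lies in one of the four half-planes at distance
  \<open>r\<close> from the origin with normals \<open>1, -1, \<i>, -\<i>\<close>; the Chernoff bound applies to each.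
\<close>

lemma (in prob_space) complex_tail_from_exponential_moments:
  fixes Z :: "'a \<Rightarrow> complex"
  assumes [measurable]: "Z \<in> borel_measurable M"
    and s: "0 < s"
    and int: "\<And>u. cmod u = 1 \<Longrightarrow> integrable M (\<lambda>\<omega>. exp (s * Re (u * Z \<omega>)))"
    and le: "\<And>u. cmod u = 1 \<Longrightarrow> expectation (\<lambda>\<omega>. exp (s * Re (u * Z \<omega>))) \<le> K"
  shows "prob {\<omega>\<in>space M. sqrt 2 * r \<le> cmod (Z \<omega>)} \<le> 4 * K * exp (- s * r)"
proof -
  let ?U = "{1, -1, \<i>, -\<i>} :: complex set"
  define E where "E u = {\<omega>\<in>space M. r \<le> Re (u * Z \<omega>)}" for u
  have [measurable]: "E u \<in> sets M" for u
    unfolding E_def by measurable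
  have tail: "prob (E u) \<le> exp (- s * r) * K" if "u \<in> ?U" for u
  proof -
    have u: "cmod u = 1" using that by auto
    have "prob (E u) \<le> exp (- s * r) * (\<integral>\<omega>\<in>space M. exp (s * Re (u * Z \<omega>)) \<partial>M)"
      unfolding E_def
      by (rule Chernoff_ineq_ge[OF s])
        (use int[OF u] in \<open>simp_all only: set_integrable_def integrable_mult_indicator sets.top\<close>)
    also have "(\<integral>\<omega>\<in>space M. exp (s * Re (u * Z \<omega>)) \<partial>M) \<le> K"
      using le[OF u] int[OF u] by (subst set_integral_space) auto
    finally show ?thesis by simp
  qed
  have cover: "{\<omega>\<in>space M. sqrt 2 * r \<le> cmod (Z \<omega>)} \<subseteq> (\<Union>u\<in>?U. E u)"
  proof clarify
    fix \<omega> assume w: "\<omega> \<in> space M" "sqrt 2 * r \<le> cmod (Z \<omega>)"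
    have "r \<le> max \<bar>Re (Z \<omega>)\<bar> \<bar>Im (Z \<omega>)\<bar>" (is "r \<le> ?m")
    proof -
      have "(Re (Z \<omega>))\<^sup>2 \<le> ?m\<^sup>2" "(Im (Z \<omega>))\<^sup>2 \<le> ?m\<^sup>2"
        by (auto simp: abs_le_square_iff[symmetric])
      then have "cmod (Z \<omega>) \<le> sqrt (2 * ?m\<^sup>2)"
        unfolding cmod_def by (intro real_sqrt_le_mono) simp
      also have "\<dots> = sqrt 2 * ?m"
        by (simp add: real_sqrt_mult)
      finally show ?thesis
        using w(2) by (smt (verit) mult_le_cancel_left_pos real_sqrt_gt_zero)
    qed
    then show "\<omega> \<in> (\<Union>u\<in>?U. E u)"
      using w(1) by (auto simp: E_def abs_if max_def split: if_splits)
  qed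
  have "prob {\<omega>\<in>space M. sqrt 2 * r \<le> cmod (Z \<omega>)} \<le> prob (\<Union>u\<in>?U. E u)"
    by (rule finite_measure_mono[OF cover]) auto
  also have "\<dots> \<le> (\<Sum>u\<in>?U. prob (E u))"
    by (rule finite_measure_subadditive_finite) auto
  also have "\<dots> \<le> (\<Sum>u\<in>?U. exp (- s * r) * K)"
    by (intro sum_mono tail)
  also have "\<dots> = 4 * K * exp (- s * r)"
    by (simp add: complex_eq_iff)
  finally show ?thesis .
qed

section \<open>Circular complex Gaussian noise\<close>

text \<open>
  Completing the square shows that the factor \<open>exp (c x)\<close> turns the centred normal density into a
  multiple of the normal density with mean \<open>c s\<^sup>2\<close>.
\<close>

lemma (in prob_space) normal_exponential_moment:
  assumes s: "0 < s" and D: "distributed M lborel X (normal_density 0 s)"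
  shows "integrable M (\<lambda>\<omega>. exp (c * X \<omega>))"
    and "expectation (\<lambda>\<omega>. exp (c * X \<omega>)) = exp (c\<^sup>2 * s\<^sup>2 / 2)"
proof -
  have tilt: "normal_density 0 s x * exp (c * x) = exp (c\<^sup>2 * s\<^sup>2 / 2) * normal_density (c * s\<^sup>2) s x" for x
  proof -
    have "- (x - 0)\<^sup>2 / (2 * s\<^sup>2) + c * x = c\<^sup>2 * s\<^sup>2 / 2 + - (x - c * s\<^sup>2)\<^sup>2 / (2 * s\<^sup>2)"
      using s by (simp add: field_simps power2_eq_square)
    then have "exp (- (x - 0)\<^sup>2 / (2 * s\<^sup>2)) * exp (c * x) =
        exp (c\<^sup>2 * s\<^sup>2 / 2) * exp (- (x - c * s\<^sup>2)\<^sup>2 / (2 * s\<^sup>2))"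
      by (simp only: exp_add[symmetric])
    then show ?thesis
      unfolding normal_density_def by (simp add: mult_ac)
  qed
  have "integrable lborel (\<lambda>x. normal_density 0 s x * exp (c * x))"
    unfolding tilt using s by simp
  then show "integrable M (\<lambda>\<omega>. exp (c * X \<omega>))"
    by (subst distributed_integrable[OF D, symmetric]) auto
  have "expectation (\<lambda>\<omega>. exp (c * X \<omega>)) = (\<integral>x. normal_density 0 s x * exp (c * x) \<partial>lborel)"
    by (subst distributed_integral[OF D, symmetric]) auto
  also have "\<dots> = exp (c\<^sup>2 * s\<^sup>2 / 2)"
    unfolding tilt using s by simp
  finally show "expectation (\<lambda>\<omega>. exp (c * X \<omega>)) = exp (c\<^sup>2 * s\<^sup>2 / 2)" .
qed

lemma (in prob_space) circular_complex_normal_exponential_moment: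
  fixes \<sigma> :: real
  assumes \<sigma>: "0 < \<sigma>" and Z: "circular_complex_normal M \<sigma> Z"
  shows "integrable M (\<lambda>\<omega>. exp (Re (c * Z \<omega>)))"
    and "expectation (\<lambda>\<omega>. exp (Re (c * Z \<omega>))) = exp (\<sigma>\<^sup>2 * (cmod c)\<^sup>2 / 4)"
proof -
  have s: "0 < \<sigma> / sqrt 2" using \<sigma> by simp
  have D: "distributed M lborel (\<lambda>\<omega>. Re (Z \<omega>)) (normal_density 0 (\<sigma> / sqrt 2))"
    "distributed M lborel (\<lambda>\<omega>. Im (Z \<omega>)) (normal_density 0 (\<sigma> / sqrt 2))"
    and ind: "indep_var borel (\<lambda>\<omega>. Re (Z \<omega>)) borel (\<lambda>\<omega>. Im (Z \<omega>))"
    using Z by (auto simp: circular_complex_normal_def)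
  note re = normal_exponential_moment[OF s D(1), of "Re c"]
  note im = normal_exponential_moment[OF s D(2), of "- Im c"]
  have ind': "indep_var borel (\<lambda>\<omega>. exp (Re c * Re (Z \<omega>))) borel (\<lambda>\<omega>. exp (- Im c * Im (Z \<omega>)))"
    using indep_var_compose[OF ind, of "\<lambda>x. exp (Re c * x)" borel "\<lambda>x. exp (- Im c * x)" borel]
    by (simp add: o_def)
  have split: "exp (Re (c * Z \<omega>)) = exp (Re c * Re (Z \<omega>)) * exp (- Im c * Im (Z \<omega>))" for \<omega>
    by (simp add: exp_add[symmetric])
  show "integrable M (\<lambda>\<omega>. exp (Re (c * Z \<omega>)))"
    unfolding split by (rule indep_var_integrable[OF ind' re(1) im(1)])
  show "expectation (\<lambda>\<omega>. exp (Re (c * Z \<omega>))) = exp (\<sigma>\<^sup>2 * (cmod c)\<^sup>2 / 4)"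
    unfolding split indep_var_lebesgue_integral[OF ind' re(1) im(1)] re(2) im(2)
    by (simp add: cmod_power2 power_divide field_simps flip: exp_add)
qed

lemma (in prob_space) complex_normal_noise_exponential_moment:
  fixes \<eta> :: "'a \<Rightarrow> complex ^ 'n" and \<sigma> :: real
  assumes \<sigma>: "0 < \<sigma>" and \<eta>: "complex_normal_noise M \<sigma> \<eta>"
  shows "integrable M (\<lambda>\<omega>. exp (Re (\<Sum>i\<in>UNIV. c i * \<eta> \<omega> $ i)))"
    and "expectation (\<lambda>\<omega>. exp (Re (\<Sum>i\<in>UNIV. c i * \<eta> \<omega> $ i))) =
      exp (\<sigma>\<^sup>2 * (\<Sum>i\<in>UNIV. (cmod (c i))\<^sup>2) / 4)"
proof -
  have circ: "\<And>i. circular_complex_normal M \<sigma> (\<lambda>\<omega>. \<eta> \<omega> $ i)"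
    and ind: "indep_vars (\<lambda>_. borel) (\<lambda>i \<omega>. \<eta> \<omega> $ i) UNIV"
    using \<eta> by (auto simp: complex_normal_noise_def)
  note mom = circular_complex_normal_exponential_moment[OF \<sigma> circ]
  have ind': "indep_vars (\<lambda>_. borel) (\<lambda>i \<omega>. exp (Re (c i * \<eta> \<omega> $ i))) UNIV"
    by (rule indep_vars_compose2[OF ind, where Y = "\<lambda>i x. exp (Re (c i * x))"]) auto
  have split: "exp (Re (\<Sum>i\<in>UNIV. c i * \<eta> \<omega> $ i)) = (\<Prod>i\<in>UNIV. exp (Re (c i * \<eta> \<omega> $ i)))" for \<omega>
    by (simp only: Re_sum exp_sum finite)
  show "integrable M (\<lambda>\<omega>. exp (Re (\<Sum>i\<in>UNIV. c i * \<eta> \<omega> $ i)))"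
    unfolding split by (rule indep_vars_integrable[OF finite ind' mom(1)])
  show "expectation (\<lambda>\<omega>. exp (Re (\<Sum>i\<in>UNIV. c i * \<eta> \<omega> $ i))) =
      exp (\<sigma>\<^sup>2 * (\<Sum>i\<in>UNIV. (cmod (c i))\<^sup>2) / 4)"
    unfolding split indep_vars_lebesgue_integral[OF finite ind' mom(1)] mom(2)
    by (simp add: exp_sum[symmetric] sum_distrib_left sum_divide_distrib)
qed

lemma (in prob_space) measurable_complex_normal_noise:
  assumes "complex_normal_noise M \<sigma> \<eta>"
  shows "(\<lambda>\<omega>. \<eta> \<omega> $ i) \<in> borel_measurable M"
  using assms by (auto simp: complex_normal_noise_def indep_vars_def)

lemma (in prob_space) expectation_norm_complex_normal_noise:
  fixes \<eta> :: "'a \<Rightarrow> complex ^ 'n" and \<sigma> :: real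
  assumes \<sigma>: "0 < \<sigma>" and \<eta>: "complex_normal_noise M \<sigma> \<eta>"
  shows "expectation (\<lambda>\<omega>. (norm (\<eta> \<omega>))\<^sup>2) = CARD('n) * \<sigma>\<^sup>2"
proof -
  have s: "0 < \<sigma> / sqrt 2" using \<sigma> by simp
  have second: "integrable M (\<lambda>\<omega>. (X \<omega>)\<^sup>2)" "expectation (\<lambda>\<omega>. (X \<omega>)\<^sup>2) = \<sigma>\<^sup>2 / 2"
    if D: "distributed M lborel X (normal_density 0 (\<sigma> / sqrt 2))" for X
  proof -
    show "integrable M (\<lambda>\<omega>. (X \<omega>)\<^sup>2)"
      using integrable_normal_moment[OF s, of 0 2]
      by (subst distributed_integrable[OF D, symmetric]) auto
    show "expectation (\<lambda>\<omega>. (X \<omega>)\<^sup>2) = \<sigma>\<^sup>2 / 2"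
      using normal_distributed_variance[OF s D] normal_distributed_expectation[OF s D]
      by (simp add: power_divide)
  qed
  have D: "distributed M lborel (\<lambda>\<omega>. Re (\<eta> \<omega> $ i)) (normal_density 0 (\<sigma> / sqrt 2))"
    "distributed M lborel (\<lambda>\<omega>. Im (\<eta> \<omega> $ i)) (normal_density 0 (\<sigma> / sqrt 2))" for i
    using \<eta> by (auto simp: complex_normal_noise_def circular_complex_normal_def)
  have "(norm (\<eta> \<omega>))\<^sup>2 = (\<Sum>i\<in>UNIV. (Re (\<eta> \<omega> $ i))\<^sup>2 + (Im (\<eta> \<omega> $ i))\<^sup>2)" for \<omega>
    by (simp add: norm_vec_def L2_set_def sum_nonneg cmod_power2)
  then show ?thesis
    by (simp add: second[OF D(1)] second[OF D(2)])
qed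

lemma (in prob_space) complex_normal_noise_tail:
  fixes \<eta> :: "'a \<Rightarrow> complex ^ 'n" and \<sigma> :: real
  assumes \<sigma>: "0 < \<sigma>" and \<eta>: "complex_normal_noise M \<sigma> \<eta>"
    and c: "(\<Sum>i\<in>UNIV. (cmod (c i))\<^sup>2) = 1" and a: "0 < a"
  shows "prob {\<omega>\<in>space M. 2 * \<sigma> * a \<le> cmod (\<Sum>i\<in>UNIV. c i * \<eta> \<omega> $ i)} \<le> 4 * exp (- 2 * a\<^sup>2)"
proof -
  note [measurable] = measurable_complex_normal_noise[OF \<eta>]
  \<comment> \<open>minimizes the Chernoff exponent \<open>s\<^sup>2 \<sigma>\<^sup>2 / 4 - s (sqrt 2 \<sigma> a)\<close>\<close>
  define s where "s = 2 * sqrt 2 * a / \<sigma>"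
  have s: "0 < s" using a \<sigma> by (simp add: s_def)
  let ?Z = "\<lambda>\<omega>. \<Sum>i\<in>UNIV. c i * \<eta> \<omega> $ i"
  have rew: "s * Re (u * ?Z \<omega>) = Re (\<Sum>i\<in>UNIV. of_real s * u * c i * \<eta> \<omega> $ i)" for u \<omega>
  proof -
    have "(\<Sum>i\<in>UNIV. of_real s * u * c i * \<eta> \<omega> $ i) = of_real s * (u * ?Z \<omega>)"
      by (simp add: sum_distrib_left mult.assoc)
    then show ?thesis by simp
  qed
  have norm: "\<sigma>\<^sup>2 * (\<Sum>i\<in>UNIV. (cmod (of_real s * u * c i))\<^sup>2) / 4 = 2 * a\<^sup>2" if "cmod u = 1" for u
  proof -
    have "(\<Sum>i\<in>UNIV. (cmod (of_real s * u * c i))\<^sup>2) = s\<^sup>2"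
      using that c by (simp add: norm_mult power_mult_distrib flip: sum_distrib_left)
    then show ?thesis
      using \<sigma> by (simp add: s_def power_mult_distrib power_divide)
  qed
  have "prob {\<omega>\<in>space M. sqrt 2 * (sqrt 2 * \<sigma> * a) \<le> cmod (?Z \<omega>)} \<le>
      4 * exp (2 * a\<^sup>2) * exp (- s * (sqrt 2 * \<sigma> * a))"
    using complex_normal_noise_exponential_moment[OF \<sigma> \<eta>]
    by (intro complex_tail_from_exponential_moments[OF _ s]) (auto simp only: rew norm order_refl, measurable)
  moreover have "s * (sqrt 2 * \<sigma> * a) = 4 * a\<^sup>2" "sqrt 2 * (sqrt 2 * \<sigma> * a) = 2 * \<sigma> * a"
    using \<sigma> by (simp_all add: s_def power2_eq_square)
  moreover have "exp (2 * a\<^sup>2) * exp (- (4 * a\<^sup>2)) = exp (- 2 * a\<^sup>2)"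
    by (simp flip: exp_add)
  ultimately show ?thesis by simp
qed

section \<open>Tails of weighted sums over a random sample\<close>

lemma (in prob_space) expectation_uniform_random_permutation:
  fixes f :: "'p::finite list \<Rightarrow> real"
  assumes "uniform_random_permutation M \<pi>"
  shows "integrable M (\<lambda>\<omega>. f (\<pi> \<omega>))"
    and "expectation (\<lambda>\<omega>. f (\<pi> \<omega>)) = (\<Sum>xs\<in>permutations_of_set UNIV. f xs) / fact CARD('p)"
proof -
  let ?P = "permutations_of_set (UNIV :: 'p set)"
  have meas: "\<pi> \<in> measurable M (count_space ?P)"
    and distr: "distr M (count_space ?P) \<pi> = uniform_count_measure ?P"
    using assms by (auto simp: uniform_random_permutation_def)
  show "integrable M (\<lambda>\<omega>. f (\<pi> \<omega>))"
    by (subst integrable_distr_eq[OF meas, symmetric])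
      (auto simp: distr uniform_count_measure_def intro!: integrable_point_measure_finite)
  have "expectation (\<lambda>\<omega>. f (\<pi> \<omega>)) = (\<integral>xs. f xs \<partial>uniform_count_measure ?P)"
    by (subst integral_distr[OF meas, symmetric]) (auto simp: distr)
  also have "\<dots> = (\<Sum>xs\<in>?P. f xs) / fact CARD('p)"
    by (simp add: uniform_count_measure_def lebesgue_integral_point_measure_finite sum_divide_distrib)
  finally show "expectation (\<lambda>\<omega>. f (\<pi> \<omega>)) = (\<Sum>xs\<in>?P. f xs) / fact CARD('p)" .
qed

lemma norm_sum_le_sqrt_card_L2:
  fixes z :: "'a \<Rightarrow> complex"
  shows "cmod (\<Sum>l\<in>I. z l) \<le> sqrt (card I) * sqrt (\<Sum>l\<in>I. (cmod (z l))\<^sup>2)"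
proof -
  have "(\<Sum>l\<in>I. 1 * cmod (z l))\<^sup>2 \<le> (\<Sum>l\<in>I. 1\<^sup>2) * (\<Sum>l\<in>I. (cmod (z l))\<^sup>2)"
    by (rule Cauchy_Schwarz_ineq_sum)
  then have "(\<Sum>l\<in>I. cmod (z l)) \<le> sqrt (card I * (\<Sum>l\<in>I. (cmod (z l))\<^sup>2))"
    by (intro real_le_rsqrt) simp
  then show ?thesis
    using norm_sum[of z I] by (simp add: real_sqrt_mult)
qed

lemma sum_lessThan_pad_zeros:
  fixes k m :: nat
  shows "k \<le> m \<Longrightarrow> (\<Sum>l<m. if l < k then f l else 0) = (\<Sum>l<k. f l)"
  by (rule sum.mono_neutral_cong_right) auto

text \<open>
  The centre of the sum has modulus at most \<open>N \<mu> a\<close> by Cauchy-Schwarz and the assumption on the mean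
  of \<open>g\<close>. With the parameter \<open>s = a / (\<mu> N)\<close> the centre and the spread contribute at most \<open>a\<^sup>2\<close> each
  to the exponent, against \<open>- 10 a\<^sup>2\<close> from the level of the tail. The inequality in the event is strict
  so that the bound survives in the degenerate case \<open>\<mu> N = 0\<close>, where the sum vanishes.
\<close>

lemma (in prob_space) sample_without_replacement_tail:
  fixes g :: "'p::finite \<Rightarrow> complex" and z :: "nat \<Rightarrow> complex"
  assumes \<pi>: "uniform_random_permutation M \<pi>"
    and k: "k \<le> CARD('p)" and g: "\<And>x. cmod (g x) \<le> \<mu>" and a: "0 < a"
    and mean: "sqrt k * (cmod (\<Sum>x\<in>UNIV. g x) / CARD('p)) \<le> \<mu> * a"
  defines "N \<equiv> sqrt (\<Sum>l<k. (cmod (z l))\<^sup>2)"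
  shows "prob {\<omega>\<in>space M. 10 * \<mu> * (sqrt 2 * a) * N < cmod (\<Sum>l<k. z l * g (\<pi> \<omega> ! l))}
    \<le> 4 * exp (- 8 * a\<^sup>2)"
proof -
  define Z where "Z xs = (\<Sum>l<k. z l * g (xs ! l))" for xs
  have \<mu>0: "0 \<le> \<mu>"
    using order_trans[OF norm_ge_zero g] .
  have N0: "0 \<le> N" by (simp add: N_def sum_nonneg)
  show ?thesis
  proof (cases "\<mu> * N = 0")
    case True
    have "Z xs = 0" for xs
    proof (cases "\<mu> = 0")
      case True
      then have "g x = 0" for x using g[of x] by simp
      then show ?thesis by (simp add: Z_def)
    next
      case False
      then have "\<forall>l\<in>{..<k}. (cmod (z l))\<^sup>2 = 0"
        using \<open>\<mu> * N = 0\<close> by (subst sum_nonneg_eq_0_iff[symmetric]) (auto simp: N_def)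
      then show ?thesis by (simp add: Z_def)
    qed
    moreover have "\<not> 10 * \<mu> * (sqrt 2 * a) * N < 0"
      using \<mu>0 N0 a by (simp add: not_less)
    ultimately show ?thesis by (simp add: Z_def del: mult_less_0_iff)
  next
    case False
    then have \<mu>N: "0 < \<mu> * N" using \<mu>0 N0 by (simp add: less_le)
    have \<mu>N_nz: "\<mu> \<noteq> 0" "N \<noteq> 0" using \<mu>N by auto
    define s where "s = a / (\<mu> * N)"
    have s: "0 < s" using a \<mu>N by (simp add: s_def)
    note mom = expectation_uniform_random_permutation[OF \<pi>]
    have meas: "(\<lambda>\<omega>. Z (\<pi> \<omega>)) \<in> borel_measurable M"
    proof -
      have "\<pi> \<in> measurable M (count_space (permutations_of_set UNIV))"
        using \<pi> by (simp add: uniform_random_permutation_def)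
      then show ?thesis by (rule measurable_compose) simp
    qed
    have bound: "expectation (\<lambda>\<omega>. exp (s * Re (u * Z (\<pi> \<omega>)))) \<le> exp (2 * a\<^sup>2)" if u: "cmod u = 1" for u
    proof -
      \<comment> \<open>weights on all positions of the permutation, zero beyond the sample\<close>
      define w where "w l = (if l < k then of_real s * u * z l else 0)" for l
      note restrict = sum_lessThan_pad_zeros[OF k]
      have wsum: "(\<Sum>l<CARD('p). w l) = of_real s * u * (\<Sum>l<k. z l)"
        by (simp add: w_def restrict sum_distrib_left)
      have wsq: "(\<Sum>l<CARD('p). (cmod (w l))\<^sup>2) = s\<^sup>2 * N\<^sup>2"
      proof -
        have "(cmod (w l))\<^sup>2 = (if l < k then s\<^sup>2 * (cmod (z l))\<^sup>2 else 0)" for l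
          using u by (simp add: w_def norm_mult power_mult_distrib)
        then show ?thesis
          by (simp add: restrict N_def sum_nonneg flip: sum_distrib_left)
      qed
      have wZ: "s * Re (u * Z xs) = Re (\<Sum>l<CARD('p). w l * g (xs ! l))" for xs
      proof -
        have "w l * g (xs ! l) = (if l < k then of_real s * u * (z l * g (xs ! l)) else 0)" for l
          by (simp add: w_def)
        then have "(\<Sum>l<CARD('p). w l * g (xs ! l)) = of_real s * (u * Z xs)"
          by (simp add: restrict Z_def flip: sum_distrib_left)
        then show ?thesis by simp
      qed
      have "(\<Sum>xs\<in>permutations_of_set UNIV. exp (s * Re (u * Z xs))) \<le> fact CARD('p) *
          exp (Re ((\<Sum>l<CARD('p). w l) * (\<Sum>x\<in>UNIV. g x)) / CARD('p) +
          \<mu>\<^sup>2 * ((\<Sum>l<CARD('p). (cmod (w l))\<^sup>2) - (cmod (\<Sum>l<CARD('p). w l))\<^sup>2 / CARD('p)))"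
        unfolding wZ using g by (intro sum_exp_permutations_le) auto
      then have "expectation (\<lambda>\<omega>. exp (s * Re (u * Z (\<pi> \<omega>)))) \<le>
          exp (Re ((\<Sum>l<CARD('p). w l) * (\<Sum>x\<in>UNIV. g x)) / CARD('p) +
          \<mu>\<^sup>2 * ((\<Sum>l<CARD('p). (cmod (w l))\<^sup>2) - (cmod (\<Sum>l<CARD('p). w l))\<^sup>2 / CARD('p)))"
        unfolding mom(2)[of "\<lambda>xs. exp (s * Re (u * Z xs))"]
        by (subst pos_divide_le_eq) (simp_all only: mult.commute fact_gt_zero)
      also have "\<dots> \<le> exp (a\<^sup>2 + a\<^sup>2)"
      proof (subst exp_le_cancel_iff, rule add_mono)
        have "Re ((\<Sum>l<CARD('p). w l) * (\<Sum>x\<in>UNIV. g x)) \<le>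
            s * cmod (\<Sum>l<k. z l) * cmod (\<Sum>x\<in>UNIV. g x)"
          using complex_Re_le_cmod[of "(\<Sum>l<CARD('p). w l) * (\<Sum>x\<in>UNIV. g x)"] u s
          unfolding wsum by (simp add: norm_mult)
        also have "\<dots> \<le> s * (sqrt k * N) * cmod (\<Sum>x\<in>UNIV. g x)"
          using norm_sum_le_sqrt_card_L2[of z "{..<k}"] s
          by (intro mult_right_mono mult_left_mono) (auto simp: N_def)
        finally have "Re ((\<Sum>l<CARD('p). w l) * (\<Sum>x\<in>UNIV. g x)) / CARD('p) \<le>
            s * N * (sqrt k * (cmod (\<Sum>x\<in>UNIV. g x) / CARD('p)))"
          by (simp add: divide_right_mono mult_ac)
        also have "\<dots> \<le> s * N * (\<mu> * a)"
          using s N0 mean by (intro mult_left_mono) auto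
        also have "\<dots> = a\<^sup>2"
          using \<mu>N_nz by (simp add: s_def power2_eq_square)
        finally show "Re ((\<Sum>l<CARD('p). w l) * (\<Sum>x\<in>UNIV. g x)) / CARD('p) \<le> a\<^sup>2" .
        have "\<mu>\<^sup>2 * ((\<Sum>l<CARD('p). (cmod (w l))\<^sup>2) - (cmod (\<Sum>l<CARD('p). w l))\<^sup>2 / CARD('p))
            \<le> \<mu>\<^sup>2 * (s\<^sup>2 * N\<^sup>2)"
          unfolding wsq by (intro mult_left_mono) auto
        also have "\<dots> = a\<^sup>2"
          using \<mu>N_nz by (simp add: s_def power_divide power_mult_distrib)
        finally show "\<mu>\<^sup>2 * ((\<Sum>l<CARD('p). (cmod (w l))\<^sup>2) - (cmod (\<Sum>l<CARD('p). w l))\<^sup>2 / CARD('p))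
            \<le> a\<^sup>2" .
      qed
      finally show ?thesis by simp
    qed
    have "prob {\<omega>\<in>space M. 10 * \<mu> * (sqrt 2 * a) * N < cmod (Z (\<pi> \<omega>))} \<le>
        prob {\<omega>\<in>space M. sqrt 2 * (10 * \<mu> * a * N) \<le> cmod (Z (\<pi> \<omega>))}"
      using meas by (intro finite_measure_mono) (auto simp: mult_ac)
    also have "\<dots> \<le> 4 * exp (2 * a\<^sup>2) * exp (- s * (10 * \<mu> * a * N))"
      by (rule complex_tail_from_exponential_moments[OF meas s mom(1) bound])
    also have "s * (10 * \<mu> * a * N) = 10 * a\<^sup>2"
      using \<mu>N_nz by (simp add: s_def power2_eq_square)
    then have "4 * exp (2 * a\<^sup>2) * exp (- s * (10 * \<mu> * a * N)) = 4 * exp (- 8 * a\<^sup>2)"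
      by (simp flip: exp_add)
    finally show ?thesis by (simp add: Z_def)
  qed
qed


text \<open>
  Turns sums over all columns into sums over the sample, for functions that vanish off the support of
  the signal.
\<close>

lemma sum_over_sampled_positions:
  fixes F :: "'p::finite \<Rightarrow> 'b::comm_monoid_add"
  assumes xs: "xs \<in> permutations_of_set UNIV" and k: "k \<le> CARD('p)"
    and off: "\<And>j. j \<notin> {xs ! l | l. l < k} \<Longrightarrow> F j = 0"
  shows "(\<Sum>j\<in>UNIV. F j) = (\<Sum>l<k. F (xs ! l))"
proof -
  have "inj_on ((!) xs) {..<k}"
    using permutations_of_setD(2)[OF xs] length_finite_permutations_of_set[OF xs] k
    by (auto simp: inj_on_def nth_eq_iff_index_eq)
  then have "(\<Sum>l<k. F (xs ! l)) = sum F ((!) xs ` {..<k})"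
    by (simp add: sum.reindex)
  also have "\<dots> = (\<Sum>j\<in>UNIV. F j)"
    by (rule sum.mono_neutral_left) (use off in auto)
  finally show ?thesis ..
qed

section \<open>Interference between columns and coherence\<close>

lemma norm_vec_power2: "(norm (v :: complex ^ 'n))\<^sup>2 = (\<Sum>i\<in>UNIV. (cmod (v $ i))\<^sup>2)"
  by (simp add: norm_vec_def L2_set_def sum_nonneg)

lemma cinner_self: "cinner v v = of_real ((norm v)\<^sup>2)"
  by (simp add: cinner_def norm_vec_power2 complex_norm_square[symmetric])

lemma cnj_cinner: "cnj (cinner u v) = cinner v u"
  by (simp add: cinner_def mult.commute)

text \<open>
  The diagonal is set to zero because the inner product of a unit column with itself carries the signal
  and not interference. One sum then describes the interference both on and off the model.
\<close>

definition crosstalk :: "complex ^ 'p ^ 'n \<Rightarrow> 'p \<Rightarrow> 'p \<Rightarrow> complex" where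
  "crosstalk X j i = (if i = j then 0 else cinner (column i X) (column j X))"

lemma correlation_decomposition:
  fixes X :: "complex ^ 'p ^ 'n"
  assumes "norm (column j X) = 1"
  shows "(hermitian_transpose X *v (X *v b + e)) $ j =
    b $ j + (\<Sum>i\<in>UNIV. b $ i * crosstalk X j i) + (\<Sum>r\<in>UNIV. cnj (X $ r $ j) * e $ r)"
proof -
  have "(hermitian_transpose X *v (X *v b)) $ j = (\<Sum>i\<in>UNIV. b $ i * cinner (column i X) (column j X))"
    by (simp add: hermitian_transpose_def matrix_vector_mult_def cinner_def column_def
        sum_distrib_left mult_ac) (rule sum.swap)
  also have "\<dots> = (\<Sum>i\<in>UNIV. (if i = j then b $ i else 0) + b $ i * crosstalk X j i)"
    using assms by (intro sum.cong) (auto simp: crosstalk_def cinner_self)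
  also have "\<dots> = b $ j + (\<Sum>i\<in>UNIV. b $ i * crosstalk X j i)"
    by (simp add: sum.distrib)
  finally show ?thesis
    by (simp add: matrix_vector_right_distrib)
      (simp add: hermitian_transpose_def matrix_vector_mult_def)
qed

lemma cmod_crosstalk_le:
  fixes X :: "complex ^ 'p ^ 'n"
  assumes "2 \<le> CARD('p)"
  shows "cmod (crosstalk X j i) \<le> worst_coherence X"
proof -
  let ?C = "{cmod (cinner (column i X) (column j X)) | i j. i \<noteq> j}"
  have "?C \<subseteq> (\<lambda>(i, j). cmod (cinner (column i X) (column j X))) ` UNIV" by auto
  then have fin: "finite ?C" by (rule finite_subset) simp
  have le: "cmod (cinner (column i X) (column j X)) \<le> worst_coherence X" if "i \<noteq> j" for i j
    unfolding worst_coherence_def using that by (intro Max_ge[OF fin]) auto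
  obtain i' j' :: 'p where "i' \<noteq> j'"
    using assms by (metis (full_types) UNIV_I card_le_Suc0_iff_eq finite not_less_eq_eq numeral_2_eq_2)
  then have "0 \<le> worst_coherence X"
    using le order_trans[OF norm_ge_zero] by blast
  then show ?thesis
    using le by (simp add: crosstalk_def)
qed

text \<open>
  Dividing by \<open>p\<close> rather than by \<open>p - 1\<close> as in the average coherence is right here, since the zero
  diagonal entry belongs to the population that is sampled.
\<close>

lemma cmod_sum_crosstalk_le:
  fixes X :: "complex ^ 'p ^ 'n"
  assumes "2 \<le> CARD('p)"
  shows "cmod (\<Sum>i\<in>UNIV. crosstalk X j i) / CARD('p) \<le> average_coherence X"
proof -
  let ?m = "cmod (\<Sum>i\<in>UNIV - {j}. cinner (column j X) (column i X))"
  have "(\<Sum>i\<in>UNIV. crosstalk X j i) = (\<Sum>i\<in>UNIV - {j}. cinner (column i X) (column j X))"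
    by (simp add: crosstalk_def sum.remove[of UNIV j])
  also have "\<dots> = cnj (\<Sum>i\<in>UNIV - {j}. cinner (column j X) (column i X))"
    by (simp add: cnj_cinner)
  finally have "cmod (\<Sum>i\<in>UNIV. crosstalk X j i) = ?m"
    by (simp only: complex_mod_cnj)
  moreover have "?m / CARD('p) \<le> ?m / (real CARD('p) - 1)"
    using assms by (intro divide_left_mono) auto
  moreover have "?m / (real CARD('p) - 1) \<le> average_coherence X"
  proof -
    have "?m \<le> Max (range (\<lambda>i. cmod (\<Sum>j\<in>UNIV - {i}. cinner (column i X) (column j X))))"
      by (intro Max_ge) auto
    then show ?thesis
      using assms by (simp add: average_coherence_def divide_right_mono)
  qed
  ultimately show ?thesis by (metis order_trans)
qed

text \<open>
  This is where the average coherence and the sparsity enter: \<open>\<nu> \<le> \<mu> / sqrt n\<close> and \<open>k \<le> n / (2 L)\<close>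
  keep the centre of the interference below the scale of its fluctuations.
\<close>

lemma mean_crosstalk_le:
  fixes X :: "complex ^ 'p ^ 'n"
  assumes coh: "coherence_property X" and p: "2 \<le> CARD('p)" and L: "1 \<le> L"
    and k: "real k \<le> real CARD('n) / (2 * L)"
  shows "sqrt k * (cmod (\<Sum>i\<in>UNIV. crosstalk X j i) / CARD('p)) \<le> worst_coherence X * sqrt L"
proof -
  have \<mu>: "0 \<le> worst_coherence X"
    using cmod_crosstalk_le[OF p, of X] order_trans[OF norm_ge_zero] by blast
  have "sqrt k * (cmod (\<Sum>i\<in>UNIV. crosstalk X j i) / CARD('p)) \<le>
      sqrt k * (worst_coherence X / sqrt (real CARD('n)))"
    using cmod_sum_crosstalk_le[OF p, of X j] coh
    by (intro mult_left_mono) (auto simp: coherence_property_def)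
  also have "\<dots> = worst_coherence X * sqrt (real k / CARD('n))"
    by (simp add: real_sqrt_divide)
  also have "\<dots> \<le> worst_coherence X * sqrt L"
  proof (intro mult_left_mono[OF _ \<mu>] real_sqrt_le_mono)
    have "real k \<le> CARD('n) / (2 * L)" by (rule k)
    also have "\<dots> \<le> CARD('n) / 1"
      using L by (intro divide_left_mono) auto
    finally have "real k / CARD('n) \<le> 1" by simp
    then show "real k / CARD('n) \<le> L" using L by linarith
  qed
  finally show ?thesis .
qed

section \<open>Thresholding\<close>

lemma OST_eq_model:
  assumes f: "\<And>i. (hermitian_transpose X *v y) $ i = b $ i + W i + V i"
    and W: "\<And>i. cmod (W i) \<le> t * T" and V: "\<And>i. cmod (V i) \<le> (1 - t) * T"
    and big: "\<And>i. b $ i \<noteq> 0 \<Longrightarrow> 2 * T < cmod (b $ i)"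
  shows "OST X y T = model b"
proof (rule set_eqI)
  fix i
  have err: "cmod (W i + V i) \<le> T"
    using norm_triangle_ineq[of "W i" "V i"] W[of i] V[of i] by (simp add: algebra_simps)
  show "i \<in> OST X y T \<longleftrightarrow> i \<in> model b"
  proof (cases "b $ i = 0")
    case True
    then show ?thesis using err by (simp add: OST_def model_def f)
  next
    case False
    have "cmod (b $ i) \<le> cmod (b $ i + W i + V i) + cmod (W i + V i)"
      using norm_triangle_ineq4[of "b $ i + W i + V i" "W i + V i"] by (simp add: algebra_simps)
    with big[OF False] err have "T < cmod (b $ i + W i + V i)" by linarith
    with False show ?thesis by (simp add: OST_def model_def f)
  qed
qed

text \<open>
  Write \<open>\<mu>\<close> for the coherence, \<open>L\<close> for \<open>log p\<close>, \<open>N\<close> for the norm of the signal, \<open>q\<close> for \<open>n SNR\<close> and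
  \<open>B\<close> for the smallest signal amplitude. The threshold is the maximum of the interference level divided
  by \<open>t\<close> and the noise level divided by \<open>1 - t\<close>, and the two bounds on MAR are the squares of twice
  these two quantities, relative to \<open>N\<^sup>2 / k\<close>.
\<close>

lemma threshold_splits_error_budget:
  fixes \<mu> \<sigma> t L N T q :: real
  assumes t: "0 < t" "t < 1" and \<sigma>: "0 < \<sigma>" and \<mu>: "0 \<le> \<mu>" and L: "0 < L" and N: "0 \<le> N"
    and q: "q = N\<^sup>2 / \<sigma>\<^sup>2"
    and T: "T = max (1 / t * 10 * \<mu> * sqrt q) (1 / (1 - t) * sqrt 2) * sqrt (2 * \<sigma>\<^sup>2 * L)"
  shows "10 * \<mu> * (sqrt 2 * sqrt L) * N \<le> t * T" and "2 * \<sigma> * sqrt L \<le> (1 - t) * T"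
    and "0 < k \<Longrightarrow> 0 \<le> B \<Longrightarrow>
      max (8 / (1 - t)\<^sup>2 * (2 * real k * L / q)) (400 / t\<^sup>2 * (2 * real k * L * \<mu>\<^sup>2)) <
        B\<^sup>2 / (N\<^sup>2 / real k) \<Longrightarrow> 2 * T < B"
proof -
  define P where "P = 10 * \<mu> * (sqrt 2 * sqrt L) * N / t"
  define Q where "Q = 2 * \<sigma> * sqrt L / (1 - t)"
  have T': "T = max P Q"
  proof -
    have "1 / t * 10 * \<mu> * sqrt q * sqrt (2 * \<sigma>\<^sup>2 * L) = P"
      using \<sigma> N by (simp add: P_def q real_sqrt_mult real_sqrt_divide)
    moreover have "1 / (1 - t) * sqrt 2 * sqrt (2 * \<sigma>\<^sup>2 * L) = Q"
      using \<sigma> by (simp add: Q_def real_sqrt_mult)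
    ultimately show ?thesis
      unfolding T using L by (subst max_mult_distrib_right) simp
  qed
  have "t * P \<le> t * T" "(1 - t) * Q \<le> (1 - t) * T"
    using t by (auto simp: T' intro!: mult_left_mono)
  then show "10 * \<mu> * (sqrt 2 * sqrt L) * N \<le> t * T" "2 * \<sigma> * sqrt L \<le> (1 - t) * T"
    using t by (simp_all add: P_def Q_def)
  assume k: "0 < k" and B: "0 \<le> B"
    and mar: "max (8 / (1 - t)\<^sup>2 * (2 * real k * L / q)) (400 / t\<^sup>2 * (2 * real k * L * \<mu>\<^sup>2)) <
        B\<^sup>2 / (N\<^sup>2 / real k)"
  \<comment> \<open>if \<open>N = 0\<close>, then \<open>B\<^sup>2 / 0 = 0\<close> would have to exceed a nonnegative number\<close>
  have "N \<noteq> 0"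
  proof
    assume "N = 0"
    moreover have "0 \<le> 400 / t\<^sup>2 * (2 * real k * L * \<mu>\<^sup>2)" using L by simp
    ultimately show False using mar by simp
  qed
  then have Nk: "0 < N\<^sup>2 / real k" using k by simp
  have "(2 * Q)\<^sup>2 = 8 / (1 - t)\<^sup>2 * (2 * real k * L / q) * (N\<^sup>2 / real k)"
    using \<open>N \<noteq> 0\<close> \<sigma> k L by (simp add: Q_def q power_mult_distrib power_divide field_simps)
  also have "\<dots> < B\<^sup>2 / (N\<^sup>2 / real k) * (N\<^sup>2 / real k)"
    using mar Nk by (intro mult_strict_right_mono) auto
  also have "\<dots> = B\<^sup>2" using Nk by (metis less_irrefl nonzero_divide_eq_eq)
  finally have Q: "2 * Q < B" using B by (rule power2_less_imp_less)
  have "(2 * P)\<^sup>2 = 400 / t\<^sup>2 * (2 * real k * L * \<mu>\<^sup>2) * (N\<^sup>2 / real k)"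
    using k L by (simp add: P_def power_mult_distrib power_divide field_simps)
  also have "\<dots> < B\<^sup>2 / (N\<^sup>2 / real k) * (N\<^sup>2 / real k)"
    using mar Nk by (intro mult_strict_right_mono) auto
  also have "\<dots> = B\<^sup>2" using Nk by (metis less_irrefl nonzero_divide_eq_eq)
  finally have "2 * P < B" using B by (rule power2_less_imp_less)
  with Q show "2 * T < B" by (simp add: T')
qed

lemma beta_min_le: "b $ i \<noteq> 0 \<Longrightarrow> beta_min b \<le> cmod (b $ i)"
  by (auto simp: beta_min_def model_def intro!: Min_le)

text \<open>The assumption makes the model nonempty, without which \<^const>\<open>beta_min\<close> is unspecified.\<close>

lemma beta_min_nonneg: "b $ i \<noteq> 0 \<Longrightarrow> 0 \<le> beta_min b"
  unfolding beta_min_def by (subst Min_ge_iff) (auto simp: model_def)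


section \<open>Exact model recovery by one-step thresholding\<close>

theorem theorem2:
  fixes X :: "complex ^ 'p ^ 'n"
    and M :: "'w measure"
    and \<eta> y :: "'w \<Rightarrow> complex ^ 'n"
    and \<beta> :: "'w \<Rightarrow> complex ^ 'p"
    and \<pi> :: "'w \<Rightarrow> 'p list"
    and z :: "nat \<Rightarrow> complex"
    and k :: nat
    and \<sigma> t :: real
    and \<tau> :: "'w \<Rightarrow> real"
  assumes "0 < k" and "k < CARD('n)" and "CARD('n) \<le> CARD('p)" and "128 \<le> CARD('p)"
    and unit_columns: "\<And>j. norm (column j X) = 1"
    and coherence: "coherence_property X"
    and "prob_space M"
    and "0 < \<sigma>"
    and noise: "complex_normal_noise M \<sigma> \<eta>"
    and permutation: "uniform_random_permutation M \<pi>"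
    and independent:
      "indep_random_elements M (count_space (permutations_of_set UNIV)) \<pi> borel \<eta>"
    and nonzero: "\<And>i. i < k \<Longrightarrow> z i \<noteq> 0"
    and signal_on: "\<And>\<omega> i. \<omega> \<in> space M \<Longrightarrow> i < k \<Longrightarrow> \<beta> \<omega> $ (\<pi> \<omega> ! i) = z i"
    and signal_off:
      "\<And>\<omega> j. \<omega> \<in> space M \<Longrightarrow> j \<notin> {\<pi> \<omega> ! i | i. i < k} \<Longrightarrow> \<beta> \<omega> $ j = 0"
    and observation: "\<And>\<omega>. \<omega> \<in> space M \<Longrightarrow> y \<omega> = X *v \<beta> \<omega> + \<eta> \<omega>"
    and "0 < t" and "t < 1"
    and threshold: "\<And>\<omega>. \<omega> \<in> space M \<Longrightarrow>
      \<tau> \<omega> = max (1 / t * 10 * worst_coherence X * sqrt (real CARD('n) * SNR M \<eta> (\<beta> \<omega>)))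
                (1 / (1 - t) * sqrt 2)
             * sqrt (2 * \<sigma>\<^sup>2 * ln (real CARD('p)))"
    and sparsity: "real k \<le> real CARD('n) / (2 * ln (real CARD('p)))"
    and mar: "\<And>\<omega>. \<omega> \<in> space M \<Longrightarrow>
      MAR k (\<beta> \<omega>) >
        max (8 / (1 - t)\<^sup>2 *
              (2 * real k * ln (real CARD('p)) / (real CARD('n) * SNR M \<eta> (\<beta> \<omega>))))
            (400 / t\<^sup>2 * (2 * real k * ln (real CARD('p)) * (worst_coherence X)\<^sup>2))"
  shows "measure M {\<omega> \<in> space M. OST X (y \<omega>) (\<tau> \<omega>) \<noteq> model (\<beta> \<omega>)} \<le> 6 / real CARD('p)"
proof -
  interpret prob_space M by fact
  define L where "L = ln (real CARD('p))"
  define \<mu> where "\<mu> = worst_coherence X"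
  define N where "N = sqrt (\<Sum>l<k. (cmod (z l))\<^sup>2)"
  define A where "A j = {\<omega>\<in>space M.
    10 * \<mu> * (sqrt 2 * sqrt L) * N < cmod (\<Sum>l<k. z l * crosstalk X j (\<pi> \<omega> ! l))}" for j
  define B where "B j = {\<omega>\<in>space M.
    2 * \<sigma> * sqrt L \<le> cmod (\<Sum>r\<in>UNIV. cnj (X $ r $ j) * \<eta> \<omega> $ r)}" for j
  have p: "2 \<le> CARD('p)" "128 \<le> real CARD('p)" and k: "k \<le> CARD('p)"
    using assms(2-4) by auto
  have L: "1 \<le> L"
    unfolding L_def using exp_le p by (subst ln_ge_iff) auto
  have \<mu>: "0 \<le> \<mu>"
    unfolding \<mu>_def using cmod_crosstalk_le[OF p(1), of X] order_trans[OF norm_ge_zero] by blast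
  have N: "0 \<le> N" by (simp add: N_def sum_nonneg)
  have \<pi>[measurable]: "\<pi> \<in> measurable M (count_space (permutations_of_set UNIV))"
    using permutation by (simp add: uniform_random_permutation_def)
  note [measurable] = measurable_complex_normal_noise[OF noise]
  have [measurable]: "A j \<in> sets M" "B j \<in> sets M" for j
  proof -
    have "(\<lambda>\<omega>. \<Sum>l<k. z l * crosstalk X j (\<pi> \<omega> ! l)) \<in> borel_measurable M"
      by (rule measurable_compose[OF \<pi>]) simp
    then show "A j \<in> sets M" unfolding A_def by measurable
    show "B j \<in> sets M" unfolding B_def by measurable
  qed

  have recovery: "OST X (y \<omega>) (\<tau> \<omega>) = model (\<beta> \<omega>)"
    if w: "\<omega> \<in> space M" and good: "\<And>j. \<omega> \<notin> A j" "\<And>j. \<omega> \<notin> B j" for \<omega>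
  proof -
    have perm: "\<pi> \<omega> \<in> permutations_of_set UNIV"
      using measurable_space[OF \<pi> w] by simp
    have "(norm (\<beta> \<omega>))\<^sup>2 = (\<Sum>l<k. (cmod (\<beta> \<omega> $ (\<pi> \<omega> ! l)))\<^sup>2)"
      unfolding norm_vec_power2
      by (rule sum_over_sampled_positions[OF perm k]) (use signal_off[OF w] in auto)
    also have "\<dots> = N\<^sup>2"
      using signal_on[OF w] by (simp add: N_def sum_nonneg)
    finally have norm: "norm (\<beta> \<omega>) = N"
      using N by (simp add: power2_eq_iff_nonneg)
    have snr: "real CARD('n) * SNR M \<eta> (\<beta> \<omega>) = N\<^sup>2 / \<sigma>\<^sup>2"
      by (simp add: SNR_def norm expectation_norm_complex_normal_noise[OF \<open>0 < \<sigma>\<close> noise])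
    note budget = threshold_splits_error_budget[OF \<open>0 < t\<close> \<open>t < 1\<close> \<open>0 < \<sigma>\<close> \<mu> _ N snr
        threshold[OF w, folded L_def \<mu>_def]]
    have cross: "(\<Sum>i\<in>UNIV. \<beta> \<omega> $ i * crosstalk X j i) = (\<Sum>l<k. z l * crosstalk X j (\<pi> \<omega> ! l))" for j
      using signal_on[OF w] signal_off[OF w]
      by (subst sum_over_sampled_positions[OF perm k]) auto
    show ?thesis
    proof (rule OST_eq_model)
      fix j
      show "(hermitian_transpose X *v y \<omega>) $ j = \<beta> \<omega> $ j +
          (\<Sum>l<k. z l * crosstalk X j (\<pi> \<omega> ! l)) + (\<Sum>r\<in>UNIV. cnj (X $ r $ j) * \<eta> \<omega> $ r)"
        unfolding observation[OF w] correlation_decomposition[OF unit_columns] cross ..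
      show "cmod (\<Sum>l<k. z l * crosstalk X j (\<pi> \<omega> ! l)) \<le> t * \<tau> \<omega>"
        using good(1)[of j] budget(1) w L by (simp add: A_def)
      show "cmod (\<Sum>r\<in>UNIV. cnj (X $ r $ j) * \<eta> \<omega> $ r) \<le> (1 - t) * \<tau> \<omega>"
        using good(2)[of j] budget(2) w L by (simp add: B_def)
      assume nz: "\<beta> \<omega> $ j \<noteq> 0"
      have "2 * \<tau> \<omega> < beta_min (\<beta> \<omega>)"
        using mar[OF w] L
        by (intro budget(3)[OF _ \<open>0 < k\<close> beta_min_nonneg[OF nz]])
          (simp_all add: MAR_def norm flip: L_def \<mu>_def)
      then show "2 * \<tau> \<omega> < cmod (\<beta> \<omega> $ j)"
        using beta_min_le[OF nz] by linarith
    qed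
  qed

  have A: "prob (A j) \<le> 4 * exp (- 8 * L)" for j
  proof -
    have "prob (A j) \<le> 4 * exp (- 8 * (sqrt L)\<^sup>2)"
      unfolding A_def N_def
    proof (rule sample_without_replacement_tail[OF permutation k])
      show "cmod (crosstalk X j x) \<le> \<mu>" for x
        unfolding \<mu>_def by (rule cmod_crosstalk_le[OF p(1)])
      show "sqrt k * (cmod (\<Sum>x\<in>UNIV. crosstalk X j x) / CARD('p)) \<le> \<mu> * sqrt L"
        unfolding \<mu>_def using coherence p(1) L sparsity[folded L_def] by (rule mean_crosstalk_le)
    qed (use L in simp)
    then show ?thesis using L by simp
  qed
  have B: "prob (B j) \<le> 4 * exp (- 2 * L)" for j
  proof -
    have "(\<Sum>r\<in>UNIV. (cmod (cnj (X $ r $ j)))\<^sup>2) = 1"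
      using norm_vec_power2[of "column j X"] unit_columns by (simp add: column_def)
    from complex_normal_noise_tail[OF \<open>0 < \<sigma>\<close> noise this, of "sqrt L"] show ?thesis
      using L by (simp add: B_def)
  qed
  have "measure M {\<omega> \<in> space M. OST X (y \<omega>) (\<tau> \<omega>) \<noteq> model (\<beta> \<omega>)} \<le> prob (\<Union>j. A j \<union> B j)"
    using recovery by (intro finite_measure_mono) auto
  also have "\<dots> \<le> (\<Sum>j\<in>UNIV. prob (A j \<union> B j))"
    by (rule finite_measure_subadditive_finite) auto
  also have "\<dots> \<le> (\<Sum>j\<in>(UNIV :: 'p set). 4 * exp (- 8 * L) + 4 * exp (- 2 * L))"
    by (intro sum_mono order_trans[OF measure_Un_le] add_mono A B) auto
  also have "\<dots> = CARD('p) * (4 * exp (- 8 * L) + 4 * exp (- 2 * L))"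
    by simp
  also have "\<dots> \<le> CARD('p) * (4 / real CARD('p) ^ 3 + 4 / real CARD('p) ^ 2)"
  proof -
    have pow: "exp (- real m * L) = 1 / real CARD('p) ^ m" for m
      using p by (simp add: L_def exp_minus exp_of_nat_mult inverse_eq_divide)
    have "exp (- 8 * L) \<le> exp (- real 3 * L)" using L by simp
    then have "exp (- 8 * L) \<le> 1 / real CARD('p) ^ 3" by (simp only: pow)
    then have "4 * exp (- 8 * L) \<le> 4 / real CARD('p) ^ 3" by linarith
    then show ?thesis
      using pow[of 2] by (intro mult_left_mono add_mono) auto
  qed
  also have "\<dots> \<le> 6 / real CARD('p)"
    using p(2) by (simp add: power2_eq_square power3_eq_cube field_simps)
  finally show ?thesis .
qed

end
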